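(* Let $n\ge 1$ and let $h:J^1(\mathbb{R}^n)\to\mathbb{R}$ be a smooth function on the first jet space $J^1(\mathbb{R}^n)\cong\mathbb{R}^{2n+1}$, with coordinates $(x^1,\dots,x^n,y_1,\dots,y_n,z)$, such that $\partial h/\partial z=0$, i.e. $h=h(x,y)$. (Thus $h=0$ represents the first order PDE $h(x,\nabla z(x))=0$.) Let $X^1_h$ be the odd-symplectic Hamiltonian vector field of $h$ and let $X_c$ be the characteristic vector field of the PDE. Then $X^1_h$ and $X_c$ commute, i.e. $[X_c,X^1_h]=0$ on $J^1(\mathbb{R}^n)$. Moreover, $X^1_h=X_c$ at every point of the set $\{h=0\}\subset J^1(\mathbb{R}^n)$.
   Context: The first jet space $J^1(\mathbb{R}^n)$ has coordinates $(x,y,z)$, where $y_i$ stands for $\partial z/\partial x^i$, and carries the contact form $\theta=dz-y_i\,dx^i$ (summation over repeated indices). For a smooth function $h=h(x,y)$ the odd-symplectic (contact) Hamiltonian vector field $X^1_h$ on $J^1(\mathbb{R}^n)$ is the vector field whose integral curves satisfy $$\frac{dx^i}{ds}=\frac{\partial h}{\partial y_i},\qquad \frac{dy_i}{ds}=-\frac{\partial h}{\partial x^i},\qquad \frac{dz}{ds}=-h+y_i\frac{\partial h}{\partial y_i}.$$ For a smooth function $h=h(x,y,z)$ the characteristic vector field $X_c$ of the PDE $h(x,\nabla z(x),z(x))=0$ is the vector field on $J^1(\mathbb{R}^n)$ whose integral curves satisfy $$\frac{dx^i}{ds}=\frac{\partial h}{\partial y_i},\qquad \frac{dy_i}{ds}=-\frac{\partial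 h}{\partial x^i}-y_i\frac{\partial h}{\partial z},\qquad \frac{dz}{ds}=y_i\frac{\partial h}{\partial y_i}.$$ *)

theory Defs
  imports "HOL-Analysis.Analysis"
begin

primrec Ck :: "nat \<Rightarrow> ('a::real_normed_vector \<Rightarrow> 'b::real_normed_vector) \<Rightarrow> bool" where
  "Ck 0 f \<longleftrightarrow> continuous_on UNIV f"
| "Ck (Suc k) f \<longleftrightarrow>
     (\<forall>p. f differentiable (at p)) \<and> (\<forall>v. Ck k (\<lambda>p. frechet_derivative f (at p) v))"

text \<open>\<^const>\<open>Ck\<close> controls derivatives direction by direction, which agrees with the usual notion
  of \<open>C\<^sup>k\<close> because it is only used on finite-dimensional domains.\<close>

definition smooth :: "('a::euclidean_space \<Rightarrow> 'b::real_normed_vector) \<Rightarrow> bool" where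
  "smooth f \<longleftrightarrow> (\<forall>k. Ck k f)"

text \<open>Points of \<open>J\<^sup>1(\<real>\<^sup>n)\<close> in the global coordinates \<open>(x, y, z)\<close>. Tangent
  vectors are identified with their component tuples in the same type, so a vector field is a map
  from the jet space to itself.\<close>

type_synonym 'n jet1 = "(real ^ 'n) \<times> (real ^ 'n) \<times> real"

definition partial_deriv :: "'a::real_normed_vector \<Rightarrow> ('a \<Rightarrow> real) \<Rightarrow> 'a \<Rightarrow> real" where
  "partial_deriv e f p = deriv (\<lambda>t. f (p + t *\<^sub>R e)) 0"

definition d_x :: "'n::finite \<Rightarrow> ('n jet1 \<Rightarrow> real) \<Rightarrow> 'n jet1 \<Rightarrow> real" where
  "d_x i = partial_deriv (axis i 1, 0, 0)"

definition d_y :: "'n::finite \<Rightarrow> ('n jet1 \<Rightarrow> real) \<Rightarrow> 'n jet1 \<Rightarrow> real" where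
  "d_y i = partial_deriv (0, axis i 1, 0)"

definition d_z :: "('n::finite jet1 \<Rightarrow> real) \<Rightarrow> 'n jet1 \<Rightarrow> real" where
  "d_z = partial_deriv (0, 0, 1)"

text \<open>Only meaningful for \<open>h\<close> with \<open>d_z h = 0\<close>, that is, \<open>h = h(x, y)\<close>.\<close>

definition contact_field :: "('n::finite jet1 \<Rightarrow> real) \<Rightarrow> 'n jet1 \<Rightarrow> 'n jet1" where
  "contact_field h = (\<lambda>(x, y, z).
     (\<chi> i. d_y i h (x, y, z),
      \<chi> i. - d_x i h (x, y, z),
      - h (x, y, z) + (\<Sum>i\<in>UNIV. y $ i * d_y i h (x, y, z))))"

definition characteristic_field :: "('n::finite jet1 \<Rightarrow> real) \<Rightarrow> 'n jet1 \<Rightarrow> 'n jet1" where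
  "characteristic_field h = (\<lambda>(x, y, z).
     (\<chi> i. d_y i h (x, y, z),
      \<chi> i. - d_x i h (x, y, z) - y $ i * d_z h (x, y, z),
      \<Sum>i\<in>UNIV. y $ i * d_y i h (x, y, z)))"

text \<open>The coordinate formula \<open>[X, Y]\<^sup>j = X\<^sup>i \<partial>\<^sub>i Y\<^sup>j - Y\<^sup>i \<partial>\<^sub>i X\<^sup>j\<close>,
  for differentiable vector fields on a vector space.\<close>

definition lie_bracket ::
  "('a::euclidean_space \<Rightarrow> 'a) \<Rightarrow> ('a \<Rightarrow> 'a) \<Rightarrow> 'a \<Rightarrow> 'a" where
  "lie_bracket X Y p = frechet_derivative Y (at p) (X p) - frechet_derivative X (at p) (Y p)"

end

theory Submission
  imports Defs
begin

text \<open>Where \<open>\<partial>h/\<partial>z = 0\<close> the two fields satisfy \<open>X\<^sup>1 = X\<^sub>c - h \<partial>\<^sub>z\<close>, which gives equality on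
  \<open>{h = 0}\<close> and \<open>[X\<^sub>c, X\<^sup>1] = - (X\<^sub>c h) \<partial>\<^sub>z - h [X\<^sub>c, \<partial>\<^sub>z]\<close>. Both terms vanish: \<open>X\<^sub>c\<close> preserves
  \<open>h\<close>, and \<open>X\<^sub>c\<close> is invariant under translations in \<open>z\<close> because \<open>h\<close> is.\<close>

text \<open>Chain rule along a line. An arbitrary parameter \<open>s\<close> is allowed because
  constancy along the whole line needs the derivative everywhere, whereas partial derivatives need
  only \<open>s = 0\<close>.\<close>

lemma has_vector_derivative_along_line:
  assumes "f differentiable (at (p + s *\<^sub>R e))"
  shows "((\<lambda>t. f (p + t *\<^sub>R e)) has_vector_derivative
           frechet_derivative f (at (p + s *\<^sub>R e)) e) (at s)"
proof -
  let ?D = "frechet_derivative f (at (p + s *\<^sub>R e))"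
  have line: "((\<lambda>t. p + t *\<^sub>R e) has_derivative (\<lambda>t. t *\<^sub>R e)) (at s)"
    by (auto intro!: derivative_eq_intros)
  have "(f has_derivative ?D) (at (p + s *\<^sub>R e))"
    using assms by (simp add: frechet_derivative_works)
  then have "((\<lambda>t. f (p + t *\<^sub>R e)) has_derivative (\<lambda>t. ?D (t *\<^sub>R e))) (at s)"
    by (rule has_derivative_compose[OF line])
  then show ?thesis
    using linear_frechet_derivative[OF assms]
    by (simp add: has_vector_derivative_def linear_scale)
qed

lemma partial_deriv_eq_frechet_derivative:
  assumes "f differentiable (at p)"
  shows "partial_deriv e f p = frechet_derivative f (at p) e"
  unfolding partial_deriv_def
  using has_vector_derivative_along_line[of f p 0 e] assms
  by (simp add: has_real_derivative_iff_has_vector_derivative[symmetric] DERIV_imp_deriv)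

lemma partial_deriv_zero_imp_translation_invariant:
  assumes "\<And>p. f differentiable (at p)" "\<And>p. partial_deriv e f p = 0"
  shows "f (p + t *\<^sub>R e) = f p"
proof -
  have "((\<lambda>t. f (p + t *\<^sub>R e)) has_real_derivative 0) (at s)" for s
    using has_vector_derivative_along_line[of f p s e] assms
    by (simp add: has_real_derivative_iff_has_vector_derivative
        partial_deriv_eq_frechet_derivative[OF assms(1)])
  then show ?thesis
    using DERIV_isconst_all[of "\<lambda>t. f (p + t *\<^sub>R e)" t 0] by simp
qed

lemma partial_deriv_translate:
  assumes "\<And>p. f (p + u) = f p"
  shows "partial_deriv e f (p + u) = partial_deriv e f p"
  unfolding partial_deriv_def
  using assms[of "p + t *\<^sub>R e" for t] by (simp add: add_ac)

lemma frechet_derivative_translation_invariant: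
  assumes "f differentiable (at p)" "\<And>t. f (p + t *\<^sub>R e) = f p"
  shows "frechet_derivative f (at p) e = 0"
proof -
  have "((\<lambda>t::real. f p) has_vector_derivative frechet_derivative f (at p) e) (at 0)"
    using has_vector_derivative_along_line[of f p 0 e] assms by simp
  then show ?thesis
    using vector_derivative_unique_at has_vector_derivative_const by blast
qed

lemma smooth_imp_differentiable:
  assumes "smooth f"
  shows "f differentiable (at p)"
  using assms unfolding smooth_def by (metis Ck.simps(2))

text \<open>The bracket differentiates fields built from first partials of \<open>h\<close>, so
  second-order smoothness is what matters: unfolding \<open>Ck\<close> at level 2 makes each
  directional derivative differentiable.\<close>

lemma smooth_imp_differentiable_partial_deriv:
  fixes f :: "'a::euclidean_space \<Rightarrow> real"
  assumes "smooth f"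
  shows "partial_deriv e f differentiable (at p)"
proof -
  have "partial_deriv e f = (\<lambda>p. frechet_derivative f (at p) e)"
    using assms by (simp add: fun_eq_iff partial_deriv_eq_frechet_derivative smooth_imp_differentiable)
  moreover have "Ck (Suc (Suc 0)) f"
    using assms unfolding smooth_def by blast
  ultimately show ?thesis
    by simp
qed

lemma differentiable_vec_lambda:
  fixes f :: "'n::finite \<Rightarrow> 'a::real_normed_vector \<Rightarrow> real"
  assumes "\<And>i. f i differentiable (at p within S)"
  shows "(\<lambda>p. \<chi> i. f i p) differentiable (at p within S)"
proof -
  \<comment> \<open>Expanding in the standard basis reduces the claim to finite sums and to scalar
    multiples of constant vectors.\<close>
  have "(\<lambda>p. \<chi> i. f i p) = (\<lambda>p. \<Sum>i\<in>UNIV. f i p *\<^sub>R axis i 1)"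
    using basis_expansion[of "\<chi> i. f i p" for p] by (simp add: scalar_mult_eq_scaleR)
  then show ?thesis
    using assms by (auto intro!: differentiable_sum differentiable_scaleR)
qed

lemma differentiable_characteristic_field:
  fixes h :: "'n::finite jet1 \<Rightarrow> real"
  assumes "smooth h"
  shows "characteristic_field h differentiable (at p)"
proof -
  have "characteristic_field h = (\<lambda>p. (\<chi> i. d_y i h p,
      \<chi> i. - d_x i h p - fst (snd p) $ i * d_z h p,
      \<Sum>i\<in>UNIV. fst (snd p) $ i * d_y i h p))"
    by (auto simp: characteristic_field_def)
  moreover have "(\<lambda>p::'n jet1. fst (snd p) $ i) differentiable (at p)" for i
    by (intro bounded_linear_imp_differentiable bounded_linear_compose[OF bounded_linear_vec_nth]
        bounded_linear_compose[OF bounded_linear_fst] bounded_linear_snd)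
  moreover have "d_x i h differentiable (at p)" "d_y i h differentiable (at p)"
    "d_z h differentiable (at p)" for i
    using smooth_imp_differentiable_partial_deriv[OF assms] by (auto simp: d_x_def d_y_def d_z_def)
  ultimately show ?thesis
    by (auto intro!: differentiable_Pair differentiable_vec_lambda)
qed

lemma contact_field_eq:
  assumes "d_z h p = 0"
  shows "contact_field h p = characteristic_field h p - h p *\<^sub>R (0, 0, 1)"
  using assms by (cases p) (simp add: contact_field_def characteristic_field_def)

text \<open>Conservation of \<open>h\<close> along its characteristics: the x-part contributes the
  sum of \<open>d_y i h p * d_x i h p\<close>, the y-part its negative, and the z-part vanishes with
  \<open>d_z h p\<close>.\<close>

lemma frechet_derivative_characteristic_field:
  fixes h :: "'n::finite jet1 \<Rightarrow> real"
  assumes "h differentiable (at p)" "d_z h p = 0"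
  shows "frechet_derivative h (at p) (characteristic_field h p) = 0"
proof -
  let ?D = "frechet_derivative h (at p)"
  obtain x y z where p: "p = (x, y, z)"
    by (cases p)
  have lin: "linear ?D"
    by (rule linear_frechet_derivative[OF assms(1)])
  have axes: "d_x i h p = ?D (axis i 1, 0, 0)" "d_y i h p = ?D (0, axis i 1, 0)"
    "?D (0, 0, 1) = 0" for i
    using assms by (simp_all add: d_x_def d_y_def d_z_def partial_deriv_eq_frechet_derivative)
  have expand: "(a, b, c) =
      (\<Sum>i\<in>UNIV. a $ i *\<^sub>R (axis i 1, 0, 0)) + (\<Sum>i\<in>UNIV. b $ i *\<^sub>R (0, axis i 1, 0)) + c *\<^sub>R (0, 0, 1)"
    for a b :: "real ^ 'n" and c :: real
    using basis_expansion[of a] basis_expansion[of b]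
    by (simp add: prod_eq_iff fst_sum snd_sum scalar_mult_eq_scaleR)
  \<comment> \<open>The pair simplification rules are switched off so that the basis expansion stays
    a linear combination to which linearity of \<open>?D\<close> applies.\<close>
  have "?D (a, b, c) = (\<Sum>i\<in>UNIV. a $ i * d_x i h p) + (\<Sum>i\<in>UNIV. b $ i * d_y i h p)"
    for a b c
    by (subst expand)
      (simp add: linear_add[OF lin] linear_sum[OF lin] linear_scale[OF lin] axes
        del: scaleR_Pair add_Pair)
  then show ?thesis
    using assms(2)
    by (simp add: p characteristic_field_def sum_negf mult.commute)
qed

theorem theorem3p1:
  fixes h :: "'n::finite jet1 \<Rightarrow> real"
  assumes "smooth h"
    and "\<And>p. d_z h p = 0"
  shows "(\<forall>p. lie_bracket (characteristic_field h) (contact_field h) p = 0) \<and>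
         (\<forall>p. h p = 0 \<longrightarrow> contact_field h p = characteristic_field h p)"
proof (intro conjI allI impI)
  fix p
  let ?X = "characteristic_field h" and ?e = "(0, 0, 1) :: 'n jet1"
  let ?DX = "frechet_derivative ?X (at p)" and ?Dh = "frechet_derivative h (at p)"
  have h_diff: "h differentiable (at q)" for q
    using assms(1) by (rule smooth_imp_differentiable)
  have X_diff: "?X differentiable (at p)"
    using assms(1) by (rule differentiable_characteristic_field)
  have h_inv: "h (q + t *\<^sub>R ?e) = h q" for q t
    using h_diff assms(2) unfolding d_z_def
    by (rule partial_deriv_zero_imp_translation_invariant)
  \<comment> \<open>The components of \<open>?X\<close> involve only y and the partials of
    \<open>h\<close>; a shift in z changes neither.\<close>
  have "?X (p + t *\<^sub>R ?e) = ?X p" for t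
  proof -
    have "d_x i h (p + t *\<^sub>R ?e) = d_x i h p" "d_y i h (p + t *\<^sub>R ?e) = d_y i h p" for i
      unfolding d_x_def d_y_def using h_inv by (intro partial_deriv_translate; simp)+
    then show ?thesis
      by (cases p) (simp add: characteristic_field_def assms(2))
  qed
  with X_diff have DX_e: "?DX ?e = 0"
    by (rule frechet_derivative_translation_invariant)
  have contact: "contact_field h = (\<lambda>q. ?X q - h q *\<^sub>R ?e)"
    using contact_field_eq[OF assms(2)] by (rule ext)
  have "(contact_field h has_derivative (\<lambda>v. ?DX v - ?Dh v *\<^sub>R ?e)) (at p)"
    unfolding contact using X_diff h_diff[of p]
    by (intro has_derivative_diff has_derivative_scaleR_left) (simp_all add: frechet_derivative_works)
  then have "frechet_derivative (contact_field h) (at p) = (\<lambda>v. ?DX v - ?Dh v *\<^sub>R ?e)"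
    by (rule frechet_derivative_at[symmetric])
  \<comment> \<open>The two arguments differ by a multiple of \<open>?e\<close>, which
    \<open>?DX\<close> kills. That multiple must not be multiplied out into a tuple, or
    \<open>DX_e\<close> would no longer match.\<close>
  moreover have "?DX (contact_field h p) = ?DX (?X p)"
    using linear_frechet_derivative[OF X_diff] DX_e
    by (simp add: contact linear_diff linear_scale del: scaleR_Pair)
  \<comment> \<open>The \<open>?DX (?X p)\<close> terms cancel, leaving
    \<open>- ?Dh (?X p) *\<^sub>R ?e\<close>, which is zero by conservation of
    \<open>h\<close>.\<close>
  ultimately show "lie_bracket ?X (contact_field h) p = 0"
    using frechet_derivative_characteristic_field[OF h_diff assms(2)]
    by (simp add: lie_bracket_def zero_prod_def)
next
  fix p
  assume "h p = 0"
  then show "contact_field h p = characteristic_field h p"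
    using contact_field_eq[OF assms(2)] by (simp add: zero_prod_def)
qed

end
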